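(* Let $k_0\in\mathbb{N}$ be fixed. There is $L_0\in\mathbb{N}$ (sufficiently large) such that the following holds for all $L\in\mathbb{N}$ with $L\ge L_0$, all $U\in(0,\pi/2)$, all $\Delta_3,\Delta_4>0$ with $\Delta_3\neq\Delta_4$, and all integers $k_3,k_4$ with $1\le k_3,k_4\le k_0$. The set of functions $$f_1(t)=\sin^2 t,\quad f_2(t)=\cos^2 t,\quad f_3(t)=(t-\pi L)^{\Delta_3},\quad f_4(t)=(t-\pi L)^{\Delta_4},\qquad t\in[\pi L,\pi L+U],$$ generates the following formula: there exist points $(\alpha_0^{i,k},\dots,\alpha_k^{i,k})$ generated by $f_i$ at $(U,L,k)$ (for $i=1,2$, $k\in\{k_3,k_4\}$; for $i=3$, $k=k_3$; for $i=4$, $k=k_4$), and for such points $$ \frac{\alpha_0^{3,k_3}-\pi L}{\alpha_0^{4,k_4}-\pi L} \left(\frac{\prod_{r=1}^{k_3}\tilde Z^2(\alpha_r^{3,k_3})}{\left[\prod_{r=1}^{k_3}\tilde Z^2(\alpha_r^{2,k_3})\right]\cos^2(\alpha_0^{2,k_3})+\left[\prod_{r=1}^{k_3}\tilde Z^2(\alpha_r^{1,k_3})\right]\sin^2(\alpha_0^{1,k_3})}\right)^{\frac1{\Delta_3}} $$ $$ \times\left(\frac{\prod_{r=1}^{k_4}\tilde Z^2(\alpha_r^{4,k_4})}{\left[\prod_{r=1}^{k_4}\tilde Z^2(\alpha_r^{2,k_4})\right]\cos^2(\alpha_0^{2,k_4})+\left[\prod_{r=1}^{k_4}\tilde Z^2(\alpha_r^{1,k_4})\right]\sin^2(\alpha_0^{1,k_4})}\right)^{-\frac1{\Delta_4}}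 =\frac{(1+\Delta_4)^{1/\Delta_4}}{(1+\Delta_3)^{1/\Delta_3}} . $$
   Context: Jacob's ladder. Let $\mu\in C^\infty([y_0,\infty))$ be a fixed increasing function, unbounded above, with $\mu(y)\ge 7y\ln y$. For all sufficiently large $T$ let $x=\varphi(T)$ be the solution of $$\int_0^{\mu(x)}\left|\zeta\left(\tfrac12+it\right)\right|^2e^{-2t/x}\,dt=\int_0^T\left|\zeta\left(\tfrac12+it\right)\right|^2dt .$$ The Jacob's ladder is $\varphi_1(T)=\tfrac12\varphi(T)$; it is a continuously differentiable, strictly increasing function for $T\ge T_0$ ($T_0$ large), with $\varphi_1(T)<T$ and $\varphi_1(T)\to\infty$ as $T\to\infty$. Put $$\tilde Z^2(t)=\frac{d\varphi_1(t)}{dt}=\frac{|\zeta(\frac12+it)|^2}{\omega(t)},\qquad \omega(t)=\left\{1+O\left(\frac{\ln\ln t}{\ln t}\right)\right\}\ln t .$$ Thus $\tilde Z^2\ge 0$. Reverse iterations. For large $L\in\mathbb{N}$ and $U\in(0,\pi/2)$ set $a_0=\pi L$, $b_0=\pi L+U$, and define $a_r,b_r$ ($r\ge1$) by $\varphi_1(a_r)=a_{r-1}$, $\varphi_1(b_r)=b_{r-1}$. The segment $[a_r,b_r]$ is the $r$-th reverse iteration of $[\pi L,\pi L+U]$. Generated points. Let $f\ge0$ be a continuous function, not identically zero, on $[\pi L,\pi L+U]$, and let $k\ge1$. Points $(\alpha_0,\dots,\alpha_k)$ are said to be generated by $f$ at $(U,L,k)$ if $\alpha_k\in(a_k,b_k)$,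 $\alpha_{r-1}=\varphi_1(\alpha_r)$ for $r=1,\dots,k$ (so $\alpha_0\in(\pi L,\pi L+U)$ and $\alpha_r\in(a_r,b_r)$), and $$\int_{\pi L}^{\pi L+U}f(t)\,dt=f(\alpha_0)\left(\prod_{r=1}^k\tilde Z^2(\alpha_r)\right)(b_k-a_k).$$ (This is the mean value theorem applied to the integral after the substitution by the $k$-th iterate of $\varphi_1$.) *)

theory Defs
  imports "HOL-Complex_Analysis.Complex_Analysis"
begin

(* The half-plane Re s > 0 without 1 is connected, so the continuation of the Dirichlet series
   to it is unique; it contains the critical line, which is all that is used of the
   Riemann zeta function.  Values outside this domain are meaningless. *)
definition zeta :: "complex \<Rightarrow> complex" where
  "zeta = (SOME f. f holomorphic_on ({s. Re s > 0} - {1}) \<and>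
             (\<forall>s. Re s > 1 \<longrightarrow> (\<lambda>n. 1 / of_nat (Suc n) powr s) sums f s))"

definition zeta_sq :: "real \<Rightarrow> real" where
  "zeta_sq t = (cmod (zeta (Complex (1/2) t)))\<^sup>2"

(* One-sided derivatives at the end point y0. *)
definition smooth_from :: "real \<Rightarrow> (real \<Rightarrow> real) \<Rightarrow> bool" where
  "smooth_from y0 \<mu> \<longleftrightarrow>
     (\<exists>D :: nat \<Rightarrow> real \<Rightarrow> real. D 0 = \<mu> \<and>
        (\<forall>n. \<forall>y\<ge>y0. (D n has_real_derivative D (Suc n) y) (at y within {y0..})))"

definition ladder_eq :: "real \<Rightarrow> (real \<Rightarrow> real) \<Rightarrow> real \<Rightarrow> real \<Rightarrow> bool" where
  "ladder_eq y0 \<mu> T x \<longleftrightarrow> x \<ge> y0 \<and>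
     integral {0..\<mu> x} (\<lambda>t. zeta_sq t * exp (- 2 * t / x)) = integral {0..T} zeta_sq"

definition ladder_dom :: "real \<Rightarrow> (real \<Rightarrow> real) \<Rightarrow> real set" where
  "ladder_dom y0 \<mu> = {T. T > 0 \<and> (\<exists>!x. ladder_eq y0 \<mu> T x)}"

(* Only meaningful on ladder_dom. *)
definition phi :: "real \<Rightarrow> (real \<Rightarrow> real) \<Rightarrow> real \<Rightarrow> real" where
  "phi y0 \<mu> T = (THE x. ladder_eq y0 \<mu> T x)"

definition phi1 :: "real \<Rightarrow> (real \<Rightarrow> real) \<Rightarrow> real \<Rightarrow> real" where
  "phi1 y0 \<mu> T = phi y0 \<mu> T / 2"

definition Ztilde_sq :: "real \<Rightarrow> (real \<Rightarrow> real) \<Rightarrow> real \<Rightarrow> real" where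
  "Ztilde_sq y0 \<mu> t = deriv (phi1 y0 \<mu>) t"

(* The r-th preimage of s under phi1, taken inside the domain of the ladder. *)
primrec rev_iter :: "real \<Rightarrow> (real \<Rightarrow> real) \<Rightarrow> real \<Rightarrow> nat \<Rightarrow> real" where
  "rev_iter y0 \<mu> s 0 = s"
| "rev_iter y0 \<mu> s (Suc r) =
     (THE t. t \<in> ladder_dom y0 \<mu> \<and> phi1 y0 \<mu> t = rev_iter y0 \<mu> s r)"

(* The points are p 0, ..., p k; further values of p are irrelevant. *)
definition generated ::
  "real \<Rightarrow> (real \<Rightarrow> real) \<Rightarrow> (real \<Rightarrow> real) \<Rightarrow> real \<Rightarrow> nat \<Rightarrow> nat \<Rightarrow> (nat \<Rightarrow> real) \<Rightarrow> bool" where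
  "generated y0 \<mu> f U L k p \<longleftrightarrow>
     (let A = pi * real L; B = pi * real L + U;
          a = rev_iter y0 \<mu> A; b = rev_iter y0 \<mu> B
      in continuous_on {A..B} f \<and> (\<forall>t\<in>{A..B}. f t \<ge> 0) \<and> (\<exists>t\<in>{A..B}. f t \<noteq> 0) \<and>
         k \<ge> 1 \<and> p k \<in> {a k<..<b k} \<and>
         (\<forall>r\<in>{1..k}. p (r - 1) = phi1 y0 \<mu> (p r)) \<and>
         integral {A..B} f = f (p 0) * (\<Prod>r=1..k. Ztilde_sq y0 \<mu> (p r)) * (b k - a k))"

end

theory Submission
  imports Defs
begin

text \<open>
  Write \<open>F T\<close> for the integral of \<open>\<bar>\<zeta>(1/2 + it)\<bar>\<^sup>2\<close> over \<open>[0, T]\<close> and \<open>G x\<close> for the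
  exponentially weighted integral, so that the ladder is \<open>\<phi> = G\<^sup>-\<^sup>1 \<circ> F\<close>. Zeros of \<open>\<zeta>\<close>
  are isolated, hence \<open>F\<close> and \<open>G\<close> are strictly increasing. Both have the same (possibly infinite) limit, so \<open>\<phi>\<close> is
  defined for all large \<open>T\<close> and unbounded without any growth estimate for \<open>\<zeta>\<close>; since \<open>k\<close> is
  bounded by \<open>k\<^sub>0\<close>, the reverse iterations of large points stay in this range. The
  derivative of \<open>G\<close> is positive, so \<open>\<phi>\<close> is differentiable, and generated points arise from Lagrange's mean value theorem for
  \<open>t \<mapsto> \<integral> f\<close> over \<open>[\<pi>L, \<phi>\<^sub>1\<^sup>k(t)]\<close>. The formula follows by adding the identities for
  \<open>sin\<^sup>2\<close> and \<open>cos\<^sup>2\<close>, whose sum of integrals is \<open>U\<close>, and eliminating \<open>U\<close> and \<open>b\<^sub>k - a\<^sub>k\<close>.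
\<close>

section \<open>The zeta function on the critical line\<close>

text \<open>The expression is \<open>s - 1\<close> times the integral over \<open>[n, n + 1]\<close>
  of \<open>n powr (-s) - x powr (-s)\<close>. Two mean value estimates on the unit segment gain the
  extra power of \<open>n\<close> that makes the series converge for
  \<open>Re s > 0\<close>.\<close>

lemma zeta_summand_bound:
  fixes s :: complex and n :: nat
  assumes "Re s > 0" "n \<ge> 1"
  shows "norm ((s - 1) * of_nat n powr (-s) - of_nat n powr (1 - s) + of_nat (Suc n) powr (1 - s))
    \<le> norm s * norm (s - 1) * real n powr (- Re s - 1)"
proof -
  define S where "S = closed_segment (of_nat n :: complex) (of_nat (Suc n))"
  have S: "\<exists>x. z = of_real x \<and> real n \<le> x \<and> x \<le> real n + 1" if "z \<in> S" for z
  proof -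
    obtain u where u: "0 \<le> u" "u \<le> 1" "z = (1 - u) *\<^sub>R of_nat n + u *\<^sub>R of_nat (Suc n)"
      using \<open>z \<in> S\<close> unfolding S_def closed_segment_def by auto
    have "z = of_real (real n + u)"
      using u(3) by (simp add: scaleR_conv_of_real algebra_simps)
    then show ?thesis using u by (intro exI[of _ "real n + u"]) simp
  qed
  have nz: "z \<notin> \<real>\<^sub>\<le>\<^sub>0" if "z \<in> S" for z
    using S[OF that] assms(2) by (auto simp: complex_nonpos_Reals_iff)
  have convS: "convex S" and ends: "of_nat n \<in> S" "of_nat (Suc n) \<in> S"
    by (auto simp: S_def)
  have decay: "norm (z powr (-s) - of_nat n powr (-s)) \<le> norm s * real n powr (- Re s - 1)"
    if z: "z \<in> S" for z
  proof -
    have "norm (z powr (-s) - of_nat n powr (-s))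
        \<le> (norm s * real n powr (- Re s - 1)) * norm (z - of_nat n)"
    proof (rule field_differentiable_bound[OF convS, where f' = "\<lambda>z. (-s) * z powr (-s - 1)"])
      fix w assume w: "w \<in> S"
      show "((\<lambda>z. z powr - s) has_field_derivative - s * w powr (- s - 1)) (at w within S)"
        using has_field_derivative_powr[OF nz[OF w]] has_field_derivative_at_within by blast
      obtain x where x: "w = of_real x" "real n \<le> x" using S[OF w] by auto
      have "norm (w powr (- s - 1)) = x powr (- Re s - 1)"
        using x assms(2) by (subst norm_powr_real_powr) auto
      also have "\<dots> \<le> real n powr (- Re s - 1)"
        using x assms by (intro powr_mono2') auto
      finally show "norm (- s * w powr (- s - 1)) \<le> norm s * real n powr (- Re s - 1)"
        by (simp add: norm_mult mult_left_mono)
    qed (use z ends in auto)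
    moreover have "norm (z - of_nat n) \<le> 1"
    proof -
      obtain x where x: "z = of_real x" "real n \<le> x" "x \<le> real n + 1" using S[OF z] by auto
      have "z - of_nat n = of_real (x - real n)" using x by simp
      then show ?thesis using x by (simp del: of_real_diff)
    qed
    ultimately show ?thesis
      by (smt (verit) mult_left_le mult_nonneg_nonneg norm_ge_zero powr_ge_zero)
  qed
  \<comment> \<open>The increment of \<open>q\<close> over the segment is the summand, and its
    derivative is \<open>1 - s\<close> times the difference bounded in \<open>decay\<close>.\<close>
  define q where "q = (\<lambda>z :: complex. z powr (1 - s) + (s - 1) * of_nat n powr (-s) * z)"
  have "norm (q (of_nat (Suc n)) - q (of_nat n))
      \<le> (norm s * norm (s - 1) * real n powr (- Re s - 1)) * norm (of_nat (Suc n) - of_nat n :: complex)"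
  proof (rule field_differentiable_bound[OF convS,
        where f' = "\<lambda>z. (1 - s) * z powr (1 - s - 1) + (s - 1) * of_nat n powr (-s)"])
    fix w assume w: "w \<in> S"
    show "(q has_field_derivative (1 - s) * w powr (1 - s - 1) + (s - 1) * of_nat n powr - s) (at w within S)"
      unfolding q_def
      by (rule has_field_derivative_at_within, rule DERIV_add[OF has_field_derivative_powr[OF nz[OF w]]])
         (auto intro!: derivative_eq_intros)
    have "(1 - s) * w powr (1 - s - 1) + (s - 1) * of_nat n powr (-s)
        = (1 - s) * (w powr (-s) - of_nat n powr (-s))"
      by (simp add: algebra_simps)
    then show "norm ((1 - s) * w powr (1 - s - 1) + (s - 1) * of_nat n powr - s)
        \<le> norm s * norm (s - 1) * real n powr (- Re s - 1)"
      using mult_left_mono[OF decay[OF w], of "norm (1 - s)"]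
      by (simp add: norm_mult norm_minus_commute mult_ac)
  qed (use ends in auto)
  moreover have "q (of_nat (Suc n)) - q (of_nat n)
      = (s - 1) * of_nat n powr (-s) - of_nat n powr (1 - s) + of_nat (Suc n) powr (1 - s)"
    by (simp add: q_def algebra_simps)
  ultimately show ?thesis by simp
qed

text \<open>\<open>(s - 1) \<zeta>(s)\<close> is \<open>1\<close> plus the sum of the bounded terms above; for \<open>Re s > 1\<close> their last
  two parts telescope to \<open>- 1\<close>.\<close>

lemma zeta_continuation:
  "\<exists>f. f holomorphic_on ({s. Re s > 0} - {1}) \<and>
       (\<forall>s. Re s > 1 \<longrightarrow> (\<lambda>n. 1 / of_nat (Suc n) powr s) sums f s)"
proof -
  define b where "b = (\<lambda>(n::nat) (s::complex). (s - 1) * of_nat (Suc n) powr (-s)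
      - of_nat (Suc n) powr (1 - s) + of_nat (Suc (Suc n)) powr (1 - s))"
  have b_hol: "b n holomorphic_on A" for n A
    unfolding b_def by (intro holomorphic_intros)
  have opn: "open {s. Re s > 0}" by (simp add: open_halfspace_Re_gt)
  have "\<exists>g g'. \<forall>x \<in> {s. Re s > 0}. ((\<lambda>n. b n x) sums g x) \<and> ((\<lambda>n. deriv (b n) x) sums g' x)
      \<and> (g has_field_derivative g' x) (at x)"
  proof (rule series_and_derivative_comparison_complex[OF opn])
    fix n x
    show "(b n has_field_derivative deriv (b n) x) (at x)"
      using b_hol[of n UNIV] by (simp add: holomorphic_derivI)
  next
    fix x :: complex assume x: "x \<in> {s. Re s > 0}"
    \<comment> \<open>On the ball of this radius real parts stay at least \<open>d\<close>, so one
      summable majorant \<open>h\<close> serves the whole ball.\<close>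
    define d where "d = Re x / 2"
    define C where "C = (norm x + d) * (norm x + d + 1)"
    define h where "h = (\<lambda>n. complex_of_real (C * real (Suc n) powr (- d - 1)))"
    have d: "d > 0" using x by (simp add: d_def)
    have C: "C \<ge> 0" unfolding C_def using d by (intro mult_nonneg_nonneg) auto
    have "summable (\<lambda>n. real n powr (- d - 1))"
      using d by (subst summable_real_powr_iff) auto
    then have "summable (\<lambda>n. C * real (Suc n) powr (- d - 1))"
      by (intro summable_mult) (subst summable_Suc_iff)
    then have "summable h" unfolding h_def by (rule summable_of_real)
    moreover have "range h \<subseteq> \<real>\<^sub>\<ge>\<^sub>0" using C by (auto simp: h_def simp del: of_nat_Suc of_real_mult)
    moreover have "cmod (b n y) \<le> cmod (h n)" if y: "y \<in> ball x d \<inter> {s. Re s > 0}" for n y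
    proof -
      have dist: "norm (y - x) < d" using y by (simp add: dist_norm norm_minus_commute)
      then have Rey: "Re y \<ge> d"
        using abs_Re_le_cmod[of "y - x"] by (simp add: d_def)
      have ny: "norm y \<le> norm x + d"
        using dist norm_triangle_ineq2[of y x] by linarith
      have ny1: "norm (y - 1) \<le> norm x + d + 1"
        using ny norm_triangle_ineq4[of y 1] by simp
      have "cmod (b n y) \<le> (norm y * norm (y - 1)) * real (Suc n) powr (- Re y - 1)"
        unfolding b_def using y by (intro zeta_summand_bound) auto
      also have "\<dots> \<le> C * real (Suc n) powr (- d - 1)"
        unfolding C_def using Rey ny ny1 d by (intro mult_mono powr_mono) auto
      also have "\<dots> = cmod (h n)" using C by (simp add: h_def del: of_nat_Suc of_real_mult)
      finally show ?thesis .
    qed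
    ultimately show "\<exists>d h. 0 < d \<and> summable h \<and> range h \<subseteq> \<real>\<^sub>\<ge>\<^sub>0 \<and>
        (\<forall>\<^sub>F n in sequentially. \<forall>y\<in>ball x d \<inter> {s. 0 < Re s}. cmod (b n y) \<le> cmod (h n))"
      using d by (intro exI[of _ d] exI[of _ h]) auto
  qed
  then obtain g g' where g: "\<And>x. Re x > 0 \<Longrightarrow> (\<lambda>n. b n x) sums g x"
      "\<And>x. Re x > 0 \<Longrightarrow> (g has_field_derivative g' x) (at x)"
    by auto
  define f where "f = (\<lambda>s. (1 + g s) / (s - 1))"
  have "g holomorphic_on {s. Re s > 0} - {1}"
    using g(2) by (auto simp: holomorphic_on_def field_differentiable_def
        intro: has_field_derivative_at_within)
  then have "f holomorphic_on {s. Re s > 0} - {1}"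
    unfolding f_def by (intro holomorphic_intros) auto
  moreover have "(\<lambda>n. 1 / of_nat (Suc n) powr s) sums f s" if s: "Re s > 1" for s
  proof -
    have s1: "s \<noteq> 1" using s by auto
    have "(\<lambda>n. real n powr (1 - Re s)) \<longlonglongrightarrow> 0"
      using s tendsto_neg_powr[of "1 - Re s" "\<lambda>n. real n" sequentially]
      by (simp add: filterlim_real_sequentially)
    then have "(\<lambda>n. norm (of_nat (Suc n) powr (1 - s))) \<longlonglongrightarrow> 0"
      by (subst norm_powr_real_powr) (auto dest: LIMSEQ_Suc simp del: of_nat_Suc)
    then have "(\<lambda>n. of_nat (Suc n) powr (1 - s)) \<longlonglongrightarrow> 0"
      using tendsto_norm_zero_iff by blast
    from telescope_sums[OF this]
    have tel: "(\<lambda>n. of_nat (Suc (Suc n)) powr (1 - s) - of_nat (Suc n) powr (1 - s)) sums (- 1)"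
      by simp
    have "(\<lambda>n. b n s) sums g s" using g(1) s by simp
    from sums_diff[OF this tel] have "(\<lambda>n. (s - 1) * of_nat (Suc n) powr (-s)) sums (g s + 1)"
      by (simp add: b_def algebra_simps del: of_nat_Suc)
    from sums_divide[OF this, of "s - 1"] show ?thesis
      using s1 by (simp add: f_def powr_minus_divide add.commute del: of_nat_Suc)
  qed
  ultimately show ?thesis by blast
qed

lemma zeta_holomorphic: "zeta holomorphic_on ({s. Re s > 0} - {1})"
  and zeta_sums: "Re s > 1 \<Longrightarrow> (\<lambda>n. 1 / of_nat (Suc n) powr s) sums zeta s"
  using someI_ex[OF zeta_continuation] unfolding zeta_def[symmetric] by auto

text \<open>The series at 2 has positive real terms. This value shows that \<open>zeta\<close> does
  not vanish identically, as the identity theorem below requires.\<close>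

lemma zeta_nonzero_at_2: "zeta 2 \<noteq> 0"
proof -
  have "(\<lambda>n. Re (1 / of_nat (Suc n) powr 2 :: complex)) sums Re (zeta 2)"
    by (intro sums_Re zeta_sums) auto
  moreover have "Re (1 / of_nat (Suc n) powr 2 :: complex) = 1 / (real (Suc n))\<^sup>2" for n
    by (metis Re_complex_of_real of_nat_neq_0 of_real_1 of_real_divide of_real_of_nat_eq of_real_power powr_complexnumeral)
  ultimately have "(\<lambda>n. 1 / (real (Suc n))\<^sup>2) sums Re (zeta 2)" by simp
  then have "Re (zeta 2) \<noteq> 0"
    using suminf_pos[of "\<lambda>n. 1 / (real (Suc n))\<^sup>2"] by (auto simp: sums_iff simp del: of_nat_Suc)
  then show ?thesis by auto
qed

section \<open>The critical-line density and positivity of its weighted integrals\<close>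

lemma zeta_sq_nonneg [simp]: "zeta_sq t \<ge> 0"
  by (simp add: zeta_sq_def)

lemma continuous_on_zeta_sq [continuous_intros]:
  "continuous_on A f \<Longrightarrow> continuous_on A (\<lambda>x. zeta_sq (f x))"
proof -
  have "continuous_on UNIV (\<lambda>t. zeta (Complex (1/2) t))"
  proof (rule continuous_on_compose2[OF holomorphic_on_imp_continuous_on[OF zeta_holomorphic]])
    show "continuous_on UNIV (Complex (1/2))"
      by (auto simp: Complex_eq intro!: continuous_intros)
  qed (auto simp: complex_eq_iff)
  then have "continuous_on UNIV zeta_sq"
    unfolding zeta_sq_def[abs_def] by (intro continuous_intros)
  then show "continuous_on A f \<Longrightarrow> continuous_on A (\<lambda>x. zeta_sq (f x))"
    by (rule continuous_on_compose2) auto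
qed

text \<open>Zeros filling an interval would accumulate inside the domain of \<open>zeta\<close>, and
  the identity theorem would force \<open>zeta 2 = 0\<close>.\<close>

lemma zeta_sq_not_zero_on_interval:
  assumes "a < b"
  shows "\<exists>t\<in>{a..b}. zeta_sq t \<noteq> 0"
proof (rule ccontr)
  assume "\<not> ?thesis"
  then have zero: "zeta (Complex (1/2) t) = 0" if "t \<in> {a..b}" for t
    using that by (auto simp: zeta_sq_def)
  let ?S = "{s. Re s > 0} - {1 :: complex}"
  let ?seg = "Complex (1/2) ` {a..b}"
  have "open {s. Re s > 0}" by (simp add: open_halfspace_Re_gt)
  moreover have "convex {s. Re s > 0}" by (simp add: convex_halfspace_Re_gt)
  moreover have "{s. Re s > 0} \<noteq> {}" by (auto intro!: exI[of _ 1])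
  ultimately have op: "open ?S" and "aff_dim {s. Re s > 0} = 2"
    using aff_dim_open[of "{s. Re s > 0}"] by (auto simp: open_delete)
  \<comment> \<open>Deleting a point keeps the half-plane connected because it is convex of real
    dimension 2.\<close>
  then have conn: "connected ?S"
    using \<open>convex {s. Re s > 0}\<close> by (intro connected_punctured_convex) auto
  have "Complex (1/2) a islimpt ?seg"
    unfolding islimpt_approachable
  proof (intro allI impI)
    fix e :: real assume "e > 0"
    define t where "t = a + min (e/2) (b - a)"
    have "t \<in> {a..b}" "t \<noteq> a" "\<bar>t - a\<bar> < e" using \<open>e > 0\<close> assms by (auto simp: t_def)
    moreover have "dist (Complex (1/2) t) (Complex (1/2) a) = \<bar>t - a\<bar>"
      by (simp add: dist_norm cmod_def)
    ultimately show "\<exists>x'\<in>?seg. x' \<noteq> Complex (1/2) a \<and> dist x' (Complex (1/2) a) < e"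
      by (intro bexI[of _ "Complex (1/2) t"]) auto
  qed
  then have "zeta 2 = 0"
  proof (rule analytic_continuation[OF zeta_holomorphic op conn, rotated 2])
    show "?seg \<subseteq> ?S" "Complex (1/2) a \<in> ?S" by (auto simp: complex_eq_iff)
  qed (use zero in auto)
  then show False using zeta_nonzero_at_2 by simp
qed

text \<open>The weight is allowed to vanish at \<open>a\<close>, since two of the weights met in the
  study of \<open>K\<close> are zero at \<open>t = 0\<close>.\<close>

lemma integral_zeta_sq_mult_pos:
  assumes "a < b" "continuous_on {a..b} h" "\<And>t. t \<in> {a..b} \<Longrightarrow> h t \<ge> 0"
    and "\<And>t. t \<in> {a<..b} \<Longrightarrow> h t > 0"
  shows "integral {a..b} (\<lambda>t. zeta_sq t * h t) > 0"
proof -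
  have cont: "continuous_on {a..b} (\<lambda>t. zeta_sq t * h t)"
    using assms(2) by (intro continuous_intros)
  \<comment> \<open>A nonzero value of \<open>zeta_sq\<close> is sought in the right half, away from
    the possible zero of \<open>h\<close> at \<open>a\<close>.\<close>
  have "(a + b) / 2 < b" using assms(1) by simp
  then obtain t where t: "t \<in> {(a+b)/2..b}" "zeta_sq t \<noteq> 0"
    using zeta_sq_not_zero_on_interval by blast
  then have "t \<in> {a..b}" "zeta_sq t * h t \<noteq> 0" using assms(1) assms(4)[of t] by auto
  then have "integral {a..b} (\<lambda>t. zeta_sq t * h t) \<noteq> 0"
    using integral_eq_0_iff[OF cont assms(1)] assms(3) by auto
  moreover have "integral {a..b} (\<lambda>t. zeta_sq t * h t) \<ge> 0"
    using assms(3) by (intro integral_nonneg integrable_continuous_interval cont) auto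
  ultimately show ?thesis by simp
qed

section \<open>The ladder\<close>

locale ladder =
  fixes y0 :: real and \<mu> :: "real \<Rightarrow> real"
  assumes y0_pos: "y0 > 0"
    and smooth: "smooth_from y0 \<mu>"
    and mono: "mono_on {y0..} \<mu>"
    and unbounded: "\<not> bdd_above (\<mu> ` {y0..})"
begin

section \<open>The integrals on the two sides of the ladder equation\<close>

definition F :: "real \<Rightarrow> real" where
  "F T = integral {0..T} zeta_sq"

text \<open>Separates the two roles of the unknown in the ladder equation, damping parameter and
  upper limit, so that each can be varied alone.\<close>

definition K :: "real \<Rightarrow> real \<Rightarrow> real" where
  "K x m = integral {0..m} (\<lambda>t. zeta_sq t * exp (- 2 * t / x))"

definition G :: "real \<Rightarrow> real" where
  "G x = K x (\<mu> x)"

lemma ladder_eq_iff: "ladder_eq y0 \<mu> T x \<longleftrightarrow> x \<ge> y0 \<and> G x = F T"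
  by (simp add: ladder_eq_def G_def K_def F_def)

lemma integrand_integrable:
  "x > 0 \<Longrightarrow> (\<lambda>t. zeta_sq t * exp (- 2 * t / x)) integrable_on {a..b}"
  by (intro integrable_continuous_interval continuous_intros) auto

lemma zeta_sq_integrable: "zeta_sq integrable_on {a..b}"
  by (intro integrable_continuous_interval continuous_intros)

lemma F_strict_mono:
  assumes "0 \<le> a" "a < b"
  shows "F a < F b"
proof -
  have "F a + integral {a..b} zeta_sq = F b"
    unfolding F_def using assms by (intro Henstock_Kurzweil_Integration.integral_combine zeta_sq_integrable) auto
  moreover have "integral {a..b} (\<lambda>t. zeta_sq t * 1) > 0"
    using assms by (intro integral_zeta_sq_mult_pos) auto
  ultimately show ?thesis by simp
qed

lemma F_pos: "T > 0 \<Longrightarrow> F T > 0"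
  using F_strict_mono[of 0 T] by (simp add: F_def)

lemma F_derivative:
  assumes "T > 0"
  shows "(F has_real_derivative zeta_sq T) (at T)"
proof -
  have "((\<lambda>x. integral {0..x} zeta_sq) has_real_derivative zeta_sq T) (at T within {0..T+1})"
    using assms by (intro integral_has_real_derivative continuous_intros) auto
  then show ?thesis
    using assms at_within_Icc_at[of 0 T "T + 1"] by (simp add: F_def[abs_def])
qed

lemma continuous_on_F: "continuous_on {0..b} F"
  unfolding F_def[abs_def] by (intro indefinite_integral_continuous_1 zeta_sq_integrable)

lemma K_pos: "x > 0 \<Longrightarrow> m > 0 \<Longrightarrow> K x m > 0"
  unfolding K_def by (intro integral_zeta_sq_mult_pos continuous_intros) auto

text \<open>The integral over an empty or one-point interval is 0; this covers the range where
  \<open>\<mu>\<close> is not yet positive.\<close>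

lemma K_nonpos_eq: "m \<le> 0 \<Longrightarrow> K x m = 0"
  by (cases "m = 0") (auto simp: K_def)

lemma K_strict_mono:
  assumes "0 < x" "x < x'" "m > 0"
  shows "K x m < K x' m"
proof -
  have "integral {0..m} (\<lambda>t. zeta_sq t * (exp (- 2 * t / x') - exp (- 2 * t / x))) > 0"
    using assms
    by (intro integral_zeta_sq_mult_pos continuous_intros) (auto simp: frac_le divide_strict_left_mono)
  also have "\<dots> = K x' m - K x m"
    unfolding K_def using assms
    by (subst Henstock_Kurzweil_Integration.integral_diff[symmetric, OF integrand_integrable integrand_integrable])
       (auto simp: algebra_simps)
  finally show ?thesis by simp
qed

lemma K_mono_upper:
  assumes "x > 0" "m \<le> m'"
  shows "K x m \<le> K x m'"
  unfolding K_def using assms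
  by (intro integral_subset_le integrand_integrable) auto

lemma K_le_F: "x > 0 \<Longrightarrow> K x m \<le> F m"
  unfolding K_def F_def
  by (intro integral_le integrand_integrable zeta_sq_integrable)
     (auto intro!: mult_left_le)

text \<open>For fixed \<open>M\<close> the factor tends to 1 as \<open>x\<close> grows, so the
  damped integral recovers almost all of \<open>F M\<close>.\<close>

lemma F_le_K:
  assumes "x > 0" "M \<le> m"
  shows "exp (- 2 * M / x) * F M \<le> K x m"
proof -
  have "exp (- 2 * M / x) * F M = integral {0..M} (\<lambda>t. zeta_sq t * exp (- 2 * M / x))"
    by (simp add: F_def)
  also have "\<dots> \<le> K x M"
    unfolding K_def using assms
    by (intro integral_le integrand_integrable integrable_continuous_interval continuous_intros)
       (auto intro!: mult_left_mono divide_right_mono)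
  also have "\<dots> \<le> K x m" using assms by (rule K_mono_upper)
  finally show ?thesis .
qed

section \<open>Monotonicity and differentiability of \<open>G\<close>\<close>

lemma mu_derivative:
  assumes "y > y0"
  obtains d where "d \<ge> 0" "(\<mu> has_real_derivative d) (at y)"
proof -
  obtain E where E: "E 0 = \<mu>"
      "\<forall>n. \<forall>y\<ge>y0. (E n has_real_derivative E (Suc n) y) (at y within {y0..})"
    using smooth unfolding smooth_from_def by blast
  define d where "d = E (Suc 0) y"
  have d: "(\<mu> has_real_derivative d) (at y within {y0..})"
    using E(2)[rule_format, of y 0] E(1) assms by (simp add: d_def)
  \<comment> \<open>Beyond the end point the one-sided derivative is two-sided, because
    \<open>y\<close> lies in the open ray.\<close>
  have "at y within {y0<..} = at y" using assms by (intro at_within_open) auto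
  then have "(\<mu> has_real_derivative d) (at y)"
    using has_field_derivative_subset[OF d, of "{y0<..}"] by (force simp only: subset_eq greaterThan_iff atLeast_iff)
  moreover have "d \<ge> 0"
    using mono_on_imp_deriv_nonneg[OF mono calculation] assms by simp
  ultimately show ?thesis using that by blast
qed

lemma mu_mono: "y0 \<le> x \<Longrightarrow> x \<le> x' \<Longrightarrow> \<mu> x \<le> \<mu> x'"
  using mono by (auto simp: mono_on_def)

lemma mu_unbounded: "\<exists>x\<ge>y0. \<mu> x > M"
  using unbounded by (auto simp: bdd_above_def not_le)

lemma G_pos_iff: "x \<ge> y0 \<Longrightarrow> G x > 0 \<longleftrightarrow> \<mu> x > 0"
  using K_pos[of x "\<mu> x"] K_nonpos_eq[of "\<mu> x" x] y0_pos by (force simp: G_def not_less)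

text \<open>Positivity of \<open>\<mu>\<close> at the right end suffices: where
  \<open>\<mu> x \<le> 0\<close>, \<open>G x\<close> is 0 while \<open>G x'\<close> is
  positive.\<close>

lemma G_strict_mono:
  assumes "y0 \<le> x" "x < x'" "\<mu> x' > 0"
  shows "G x < G x'"
proof (cases "\<mu> x > 0")
  case True
  then have "G x < K x' (\<mu> x)"
    unfolding G_def using assms y0_pos by (intro K_strict_mono) auto
  also have "\<dots> \<le> G x'"
    unfolding G_def using assms y0_pos mu_mono by (intro K_mono_upper) auto
  finally show ?thesis .
next
  case False
  then show ?thesis using K_nonpos_eq[of "\<mu> x" x] G_pos_iff[of x'] assms by (simp add: G_def)
qed

text \<open>Differentiation under the integral gives the partial derivative in \<open>x\<close>, the
  fundamental theorem of calculus the one in \<open>m\<close>. Joint continuity of the latter makes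
  \<open>K\<close> totally differentiable.\<close>

lemma K_has_derivative:
  assumes "x > 0" "m > 0"
  obtains d where "d > 0"
    "((\<lambda>(x, m). K x m) has_derivative (\<lambda>(h, l). d * h + zeta_sq m * exp (- 2 * m / x) * l)) (at (x, m))"
proof -
  define d where "d = integral {0..m} (\<lambda>t. zeta_sq t * (exp (- 2 * t / x) * (2 * t / x\<^sup>2)))"
  have "d > 0" unfolding d_def using assms
    by (intro integral_zeta_sq_mult_pos continuous_intros) auto
  have "((\<lambda>x. integral (cbox 0 m) (\<lambda>t. zeta_sq t * exp (- 2 * t / x))) has_field_derivative
      integral (cbox 0 m) (\<lambda>t. zeta_sq t * (exp (- 2 * t / x) * (2 * t / x\<^sup>2)))) (at x within {0<..})"
  proof (rule leibniz_rule_field_derivative)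
    fix y t :: real assume "y \<in> {0<..}" "t \<in> cbox 0 m"
    then show "((\<lambda>x. zeta_sq t * exp (- 2 * t / x)) has_real_derivative
        zeta_sq t * (exp (- 2 * t / y) * (2 * t / y\<^sup>2))) (at y within {0<..})"
      by (auto intro!: derivative_eq_intros simp: power2_eq_square field_simps)
  next
    show "continuous_on ({0<..} \<times> cbox 0 m)
        (\<lambda>(x, t). zeta_sq t * (exp (- 2 * t / x) * (2 * t / x\<^sup>2)))"
      unfolding split_beta by (intro continuous_intros) auto
  qed (use assms in \<open>simp_all only: cbox_interval greaterThan_iff convex_real_interval integrand_integrable\<close>)
  then have fx: "((\<lambda>x. K x m) has_derivative (*) d) (at x within {0<..})"
    by (simp add: K_def d_def has_field_derivative_def)
  have "((\<lambda>(x, m). K x m) has_derivative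
      (\<lambda>(h, l). d * h + blinfun_mult_right (zeta_sq m * exp (- 2 * m / x)) l))
      (at (x, m) within {0<..} \<times> {0<..})"
  proof (rule has_derivative_partialsI[where fx = "(*) d" and fy = "\<lambda>x m. blinfun_mult_right (zeta_sq m * exp (- 2 * m / x))"])
    fix x m :: real assume xm: "x \<in> {0<..}" "m \<in> {0<..}"
    have "((\<lambda>m. K x m) has_real_derivative zeta_sq m * exp (- 2 * m / x)) (at m within {0..m+1})"
      unfolding K_def using xm by (intro integral_has_real_derivative continuous_intros) auto
    then have "((\<lambda>m. K x m) has_real_derivative zeta_sq m * exp (- 2 * m / x)) (at m)"
      using xm at_within_Icc_at[of 0 m "m + 1"] by auto
    then show "(K x has_derivative blinfun_apply (blinfun_mult_right (zeta_sq m * exp (- 2 * m / x))))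
        (at m within {0<..})"
      by (simp add: has_field_derivative_def has_derivative_at_withinI)
  next
    have "continuous_on ({0<..} \<times> {0<..})
        (\<lambda>(x, m). blinfun_mult_right (zeta_sq m * exp (- 2 * m / x)))"
      unfolding split_beta
      by (intro bounded_linear.continuous_on[OF bounded_linear_blinfun_mult_right] continuous_intros) auto
    then show "continuous (at (x, m) within {0<..} \<times> {0<..})
        (\<lambda>(x, m). blinfun_mult_right (zeta_sq m * exp (- 2 * m / x)))"
      using assms by (auto simp: continuous_on_eq_continuous_within)
  qed (use assms fx in auto)
  moreover have "at (x, m) within {0<..} \<times> {0<..} = at (x, m)"
    using assms by (intro at_within_open open_Times) auto
  ultimately show ?thesis using that[OF \<open>d > 0\<close>] by (simp add: case_prod_unfold)
qed

text \<open>Chain rule along \<open>y \<mapsto> (y, \<mu> y)\<close>. The damping contributes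
  \<open>d > 0\<close> and the moving upper limit a nonnegative term, so positivity survives at
  zeros of \<open>zeta_sq (\<mu> x)\<close>.\<close>

lemma G_derivative:
  assumes "x > y0" "\<mu> x > 0"
  obtains D where "D > 0" "(G has_real_derivative D) (at x)"
proof -
  obtain e where e: "e \<ge> 0" "(\<mu> has_real_derivative e) (at x)"
    using mu_derivative assms by blast
  obtain d where d: "d > 0" "((\<lambda>(x, m). K x m) has_derivative
      (\<lambda>(h, l). d * h + zeta_sq (\<mu> x) * exp (- 2 * \<mu> x / x) * l)) (at (x, \<mu> x))"
    using K_has_derivative[of x "\<mu> x"] assms y0_pos by auto
  let ?D = "d + zeta_sq (\<mu> x) * exp (- 2 * \<mu> x / x) * e"
  have "((\<lambda>y. (y, \<mu> y)) has_derivative (\<lambda>h. (h, e * h))) (at x)"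
    using e(2) by (auto simp: has_field_derivative_def intro!: derivative_eq_intros)
  from has_derivative_compose[OF this d(2)] have "(G has_real_derivative ?D) (at x)"
    unfolding G_def[abs_def] has_field_derivative_def case_prod_conv
    by (rule has_derivative_eq_rhs) (simp add: fun_eq_iff algebra_simps)
  moreover have "?D > 0" using d(1) e(1) by (simp add: add_pos_nonneg)
  ultimately show ?thesis using that by blast
qed

lemma isCont_G: "x > y0 \<Longrightarrow> \<mu> x > 0 \<Longrightarrow> isCont G x"
  by (erule G_derivative[of x]) (auto intro: DERIV_isCont)

text \<open>Passing from \<open>T\<close> to \<open>T + 1\<close> opens a strict gap. As
  \<open>x\<close> grows the damping on \<open>[0, T + 1]\<close> disappears and
  \<open>\<mu> x\<close> passes \<open>T + 1\<close>, so \<open>G x\<close> eventually falls within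
  this gap or above it.\<close>

lemma G_exceeds_F:
  assumes "T > 0"
  shows "\<exists>x\<ge>y0. F T < G x"
proof -
  define T' where "T' = T + 1"
  have FT: "F T < F T'" using assms F_strict_mono by (simp add: T'_def)
  have "((\<lambda>x. exp (- 2 * T' / x) * F T') \<longlongrightarrow> exp 0 * F T') at_top"
    by (intro tendsto_intros tendsto_divide_0[OF tendsto_const])
       (simp add: filterlim_at_top_imp_at_infinity filterlim_ident)
  then have large: "eventually (\<lambda>x. F T < exp (- 2 * T' / x) * F T') at_top"
    using FT by (intro order_tendstoD(1)) auto
  obtain z where z: "z \<ge> y0" "\<mu> z > T'" using mu_unbounded by blast
  obtain x where x: "x \<ge> z" "F T < exp (- 2 * T' / x) * F T'"
    using eventually_happens'[OF trivial_limit_at_top_linorder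
        eventually_conj[OF eventually_ge_at_top[of z] large]] by blast
  moreover have "exp (- 2 * T' / x) * F T' \<le> G x"
    unfolding G_def using x z y0_pos mu_mono[of z x] by (intro F_le_K) auto
  ultimately show ?thesis using z by (intro exI[of _ x]) linarith
qed

section \<open>Existence, uniqueness and smoothness of the ladder\<close>

definition x0 :: real where
  "x0 = (SOME x. x > y0 \<and> \<mu> x > 0)"

lemma x0: "x0 > y0" "\<mu> x0 > 0"
proof -
  obtain x where "x \<ge> y0" "\<mu> x > 0" using mu_unbounded by blast
  \<comment> \<open>The shift by 1 makes the inequality with \<open>y0\<close> strict, away from the
    one-sided end point.\<close>
  then have "x + 1 > y0 \<and> \<mu> (x + 1) > 0" using mu_mono[of x "x + 1"] by auto
  then show "x0 > y0" "\<mu> x0 > 0" unfolding x0_def by (rule someI2; blast)+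
qed

lemma mu_pos_above_x0: "x \<ge> x0 \<Longrightarrow> \<mu> x > 0"
  using mu_mono[of x0 x] x0 by auto

text \<open>\<open>F T > 0\<close> forces both solutions into the range where \<open>\<mu>\<close>
  is positive and \<open>G\<close> strictly increasing.\<close>

lemma ladder_solution_unique:
  assumes "T > 0" "x \<ge> y0" "G x = F T" "x' \<ge> y0" "G x' = F T"
  shows "x' = x"
proof -
  have "\<mu> x > 0" "\<mu> x' > 0" using G_pos_iff[of x] G_pos_iff[of x'] F_pos[of T] assms by auto
  then show ?thesis
    using G_strict_mono[of x x'] G_strict_mono[of x' x] assms
    by (cases x x' rule: linorder_cases) auto
qed

lemma ladder_domI:
  assumes "T > 0" "x \<ge> y0" "G x = F T"
  shows "T \<in> ladder_dom y0 \<mu>" "phi y0 \<mu> T = x"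
proof -
  have *: "ladder_eq y0 \<mu> T x' \<longleftrightarrow> x' = x" for x'
    unfolding ladder_eq_iff using ladder_solution_unique[OF assms] assms(2,3) by blast
  then show "T \<in> ladder_dom y0 \<mu>" "phi y0 \<mu> T = x"
    using assms(1) by (auto simp: ladder_dom_def phi_def Ex1_def)
qed

lemma ladder_domD:
  assumes "T \<in> ladder_dom y0 \<mu>"
  shows "T > 0" "phi y0 \<mu> T \<ge> y0" "G (phi y0 \<mu> T) = F T"
proof -
  show "T > 0" using assms by (simp add: ladder_dom_def)
  have "\<exists>!x. ladder_eq y0 \<mu> T x" using assms by (simp add: ladder_dom_def)
  then have "ladder_eq y0 \<mu> T (phi y0 \<mu> T)" unfolding phi_def by (rule theI')
  then show "phi y0 \<mu> T \<ge> y0" "G (phi y0 \<mu> T) = F T" by (simp_all add: ladder_eq_iff)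
qed

lemma phi1_strict_mono:
  assumes "T \<in> ladder_dom y0 \<mu>" "T' \<in> ladder_dom y0 \<mu>" "T < T'"
  shows "phi1 y0 \<mu> T < phi1 y0 \<mu> T'"
proof (rule ccontr)
  assume "\<not> ?thesis"
  then have "phi y0 \<mu> T' \<le> phi y0 \<mu> T" by (simp add: phi1_def)
  moreover have "\<mu> (phi y0 \<mu> T) > 0"
    using ladder_domD[OF assms(1)] F_pos[of T] G_pos_iff[of "phi y0 \<mu> T"] by simp
  ultimately have "G (phi y0 \<mu> T') \<le> G (phi y0 \<mu> T)"
    using G_strict_mono[of "phi y0 \<mu> T'" "phi y0 \<mu> T"] ladder_domD[OF assms(2)]
    by (cases "phi y0 \<mu> T' = phi y0 \<mu> T") auto
  then show False
    using ladder_domD[OF assms(1)] ladder_domD[OF assms(2)] F_strict_mono[of T T'] assms(3) by auto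
qed

lemma phi1_less_iff:
  assumes "T \<in> ladder_dom y0 \<mu>" "T' \<in> ladder_dom y0 \<mu>"
  shows "phi1 y0 \<mu> T < phi1 y0 \<mu> T' \<longleftrightarrow> T < T'"
  using phi1_strict_mono[of T T'] phi1_strict_mono[of T' T] assms
  by (cases T T' rule: linorder_cases) auto

text \<open>The threshold means \<open>phi y0 \<mu> T > x0\<close>. It excludes the end point
  \<open>y0\<close>, a possible value of \<open>phi\<close> on \<open>ladder_dom\<close>, where
  \<open>\<mu>\<close> has only one-sided derivatives.\<close>

definition regular :: "real set" where
  "regular = {T \<in> ladder_dom y0 \<mu>. phi1 y0 \<mu> T > x0 / 2}"

lemma regularD: "T \<in> regular \<Longrightarrow> T \<in> ladder_dom y0 \<mu>"
  by (simp add: regular_def)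

text \<open>The intermediate value theorem for \<open>G\<close> solves the equation for
  \<open>T'\<close> between the solution for \<open>T\<close> and a point where \<open>G\<close>
  exceeds \<open>F T'\<close>.\<close>

lemma regular_upward:
  assumes "T \<in> regular" "T \<le> T'"
  shows "T' \<in> regular"
proof -
  let ?x = "phi y0 \<mu> T"
  have T: "T \<in> ladder_dom y0 \<mu>" "?x > x0"
    using assms(1) by (auto simp: regular_def phi1_def)
  note TD = ladder_domD[OF T(1)]
  have "F T \<le> F T'" using F_strict_mono[of T T'] TD(1) assms(2) by (cases "T = T'") auto
  moreover obtain z where z: "z \<ge> y0" "F T' < G z" using G_exceeds_F[of T'] TD assms by auto
  moreover have "?x \<le> z"
  proof (rule ccontr)
    assume "\<not> ?x \<le> z"
    then have "G z < G ?x" using z T mu_pos_above_x0 by (intro G_strict_mono) auto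
    then show False using z TD \<open>F T \<le> F T'\<close> by simp
  qed
  ultimately obtain x where x: "?x \<le> x" "x \<le> z" "G x = F T'"
  proof -
    assume "F T \<le> F T'" "F T' < G z" "?x \<le> z"
    then have "\<exists>x. ?x \<le> x \<and> x \<le> z \<and> G x = F T'"
      using TD(3) T(2) x0 by (intro IVT allI impI isCont_G mu_pos_above_x0) auto
    then show thesis using that by blast
  qed
  then have "T' \<in> ladder_dom y0 \<mu>" "phi y0 \<mu> T' = x"
    using ladder_domI[of T' x] TD assms(2) by auto
  then show ?thesis using x T by (simp add: regular_def phi1_def)
qed

text \<open>The damping factor is at most 1, so \<open>G (2 * s)\<close> lies between
  \<open>F 0 = 0\<close> and \<open>F (\<mu> (2 * s))\<close>, and continuity of \<open>F\<close>
  yields \<open>T\<close>.\<close>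

lemma phi1_surj:
  assumes "s > x0 / 2"
  obtains T where "T \<in> regular" "phi1 y0 \<mu> T = s"
proof -
  have s: "2 * s > x0" using assms by simp
  have pos: "\<mu> (2 * s) > 0" using s mu_pos_above_x0 by simp
  then have Gpos: "G (2 * s) > 0" using s x0 G_pos_iff by simp
  have "G (2 * s) \<le> F (\<mu> (2 * s))"
    unfolding G_def using s x0 y0_pos by (intro K_le_F) auto
  then obtain T where T: "0 \<le> T" "F T = G (2 * s)"
    using IVT'[of F 0 "G (2 * s)" "\<mu> (2 * s)"] continuous_on_F pos Gpos by (auto simp: F_def)
  have "T \<noteq> 0" using T Gpos by (auto simp: F_def)
  then have "T \<in> ladder_dom y0 \<mu>" "phi y0 \<mu> T = 2 * s"
    using ladder_domI[of T "2 * s"] T s x0 by auto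
  then show ?thesis using that[of T] s by (auto simp: regular_def phi1_def)
qed

text \<open>Near \<open>T\<close> the ladder is half of \<open>g (F t)\<close>, with
  \<open>g\<close> the inverse of \<open>G\<close> above \<open>x0\<close>; a nonzero derivative of
  \<open>G\<close> makes \<open>g\<close> differentiable. Thus the \<open>deriv\<close> in
  \<open>Ztilde_sq\<close> is a genuine derivative.\<close>

lemma phi1_differentiable:
  assumes "T \<in> regular"
  shows "(phi1 y0 \<mu> has_real_derivative Ztilde_sq y0 \<mu> T) (at T)"
proof -
  let ?x = "phi y0 \<mu> T"
  have T: "T \<in> ladder_dom y0 \<mu>" "?x > x0"
    using assms by (auto simp: regular_def phi1_def)
  note TD = ladder_domD[OF T(1)]
  obtain D where D: "D > 0" "(G has_real_derivative D) (at ?x)"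
    using G_derivative[of ?x] T x0 mu_pos_above_x0 by auto
  define g where "g = inv_into {x0<..} G"
  have inj: "inj_on G {x0<..}"
  proof (rule linorder_inj_onI)
    show "G x \<noteq> G y" if "x < y" "x \<in> {x0<..}" "y \<in> {x0<..}" for x y
      using G_strict_mono[of x y] that x0 mu_pos_above_x0[of y] by auto
  qed auto
  have gG: "g (G x) = x" if "x > x0" for x
    unfolding g_def using inj that by (intro inv_into_f_f) auto
  obtain d where d: "d > 0" "?x - d > x0" 
    using T(2) by (intro that[of "(?x - x0) / 2"]) (auto simp: field_simps)
  have contG: "isCont G z" if "z > x0" for z
    using that isCont_G x0 mu_pos_above_x0 by auto
  have "isCont g (G ?x)"
  proof (rule isCont_inverse_function[OF d(1), where f = G and g = g])
    fix z assume "\<bar>z - ?x\<bar> \<le> d"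
    then have "z > x0" using d(2) by linarith
    then show "g (G z) = z" "isCont G z" by (rule gG, rule contG)
  qed
  moreover have "G (g y) = y" if "G (?x - d) < y" "y < G (?x + d)" for y
  proof -
    have "\<exists>z. ?x - d \<le> z \<and> z \<le> ?x + d \<and> G z = y"
      using that d by (intro IVT allI impI contG) auto
    then show ?thesis using gG d by force
  qed
  moreover have "G (?x - d) < G ?x" "G ?x < G (?x + d)"
    using d T x0 by (intro G_strict_mono; auto intro!: mu_pos_above_x0)+
  moreover have "(G has_real_derivative D) (at (g (G ?x)))" using gG[OF T(2)] D by simp
  ultimately have "(g has_real_derivative inverse D) (at (G ?x))"
    using D(1) by (intro DERIV_inverse_function[where f = G and a = "G (?x - d)" and b = "G (?x + d)"]) auto
  then have "(g has_real_derivative inverse D) (at (F T))" using TD by simp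
  then have "((\<lambda>t. g (F t) / 2) has_real_derivative inverse D * zeta_sq T / 2) (at T)"
    by (intro DERIV_cdivide DERIV_chain2[OF _ F_derivative[OF TD(1)]])
  moreover have "eventually (\<lambda>t. g (F t) / 2 = phi1 y0 \<mu> t) (nhds T)"
  proof -
    \<comment> \<open>Agreement with \<open>phi1\<close> is needed on both sides of
      \<open>T\<close>; surjectivity supplies a regular \<open>T1 < T\<close>, beyond which all
      points are regular.\<close>
    obtain s where s: "x0 / 2 < s" "s < ?x / 2" using T(2) dense[of "x0/2" "?x/2"] by auto
    then obtain T1 where T1: "T1 \<in> regular" "phi1 y0 \<mu> T1 = s" using phi1_surj by blast
    then have "T1 < T"
      using phi1_less_iff[of T1 T] T regularD s(2) by (simp add: phi1_def)
    then have "eventually (\<lambda>t. t > T1) (nhds T)"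
      using eventually_nhds_in_open[of "{T1<..}" T] by auto
    then show ?thesis
    proof eventually_elim
      case (elim t)
      then have "t \<in> regular" using regular_upward[OF T1(1)] by simp
      then show ?case
        using gG[of "phi y0 \<mu> t"] ladder_domD[of t] by (simp add: regular_def phi1_def)
    qed
  qed
  ultimately have "(phi1 y0 \<mu> has_real_derivative inverse D * zeta_sq T / 2) (at T)"
    using DERIV_cong_ev[OF refl _ refl, of "\<lambda>t. g (F t) / 2" "phi1 y0 \<mu>" T] by blast
  then show ?thesis by (metis DERIV_imp_deriv Ztilde_sq_def)
qed

section \<open>Reverse iterations and generated points\<close>

definition rev_step :: "real \<Rightarrow> real" where
  "rev_step s = (THE t. t \<in> ladder_dom y0 \<mu> \<and> phi1 y0 \<mu> t = s)"

lemma rev_iter_Suc: "rev_iter y0 \<mu> s (Suc r) = rev_step (rev_iter y0 \<mu> s r)"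
  by (simp add: rev_step_def)

declare rev_iter.simps(2) [simp del]

text \<open>The description ranges over all of \<open>ladder_dom\<close>, so strict monotonicity
  there is what excludes further, possibly nonregular preimages.\<close>

lemma rev_step:
  assumes "s > x0 / 2"
  shows "rev_step s \<in> regular" "phi1 y0 \<mu> (rev_step s) = s"
proof -
  obtain T where T: "T \<in> regular" "phi1 y0 \<mu> T = s" using phi1_surj assms by blast
  have "rev_step s = T"
    unfolding rev_step_def
  proof (rule the_equality)
    show "T \<in> ladder_dom y0 \<mu> \<and> phi1 y0 \<mu> T = s" using T by (simp add: regular_def)
    fix t assume t: "t \<in> ladder_dom y0 \<mu> \<and> phi1 y0 \<mu> t = s"
    show "t = T"
      using phi1_strict_mono[of t T] phi1_strict_mono[of T t] t T regularD[OF T(1)]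
      by (cases t T rule: linorder_cases) auto
  qed
  then show "rev_step s \<in> regular" "phi1 y0 \<mu> (rev_step s) = s" using T by simp_all
qed

lemma rev_step_strict_mono:
  assumes "s > x0 / 2" "s < s'"
  shows "rev_step s < rev_step s'"
proof -
  have s': "s' > x0 / 2" using assms by simp
  show ?thesis
    using phi1_less_iff[OF regularD[OF rev_step(1)[OF assms(1)]] regularD[OF rev_step(1)[OF s']]]
      rev_step(2)[OF assms(1)] rev_step(2)[OF s'] assms(2) by simp
qed

lemma filterlim_rev_step: "filterlim rev_step at_top at_top"
  unfolding filterlim_at_top eventually_at_top_dense
proof
  fix M
  \<comment> \<open>The maximum with a regular point makes \<open>T\<close> regular; then
    \<open>s > phi1 y0 \<mu> T\<close> forces \<open>rev_step s > T \<ge> M\<close>.\<close>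
  define T where "T = max M (rev_step (x0 / 2 + 1))"
  have T: "T \<in> regular"
    by (rule regular_upward[OF rev_step(1)[of "x0 / 2 + 1"]]) (auto simp: T_def)
  show "\<exists>N. \<forall>s>N. M \<le> rev_step s"
  proof (intro exI allI impI)
    fix s assume s: "s > phi1 y0 \<mu> T"
    then have s0: "s > x0 / 2" using T by (simp add: regular_def)
    have "T < rev_step s"
      using phi1_less_iff[OF regularD[OF T] regularD[OF rev_step(1)[OF s0]]] rev_step(2)[OF s0] s
      by simp
    then show "M \<le> rev_step s" by (simp add: T_def)
  qed
qed

lemma filterlim_rev_iter: "filterlim (\<lambda>s. rev_iter y0 \<mu> s r) at_top at_top"
proof (induction r)
  case 0
  then show ?case by (simp add: filterlim_ident)
next
  case (Suc r)
  show ?case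
    unfolding rev_iter_Suc by (rule filterlim_compose[OF filterlim_rev_step Suc.IH])
qed

text \<open>Each of finitely many iterates tends to infinity. The bound on \<open>r\<close> yields a
  threshold common to all admissible \<open>k\<close>.\<close>

lemma eventually_rev_iter_large:
  "eventually (\<lambda>s. \<forall>r\<le>n. rev_iter y0 \<mu> s r > x0 / 2) at_top"
proof -
  have "eventually (\<lambda>s. \<forall>r\<in>{..n}. rev_iter y0 \<mu> s r > x0 / 2) at_top"
    using filterlim_rev_iter unfolding filterlim_at_top_dense by (intro eventually_ball_finite) blast+
  then show ?thesis by (simp only: Ball_def atMost_iff)
qed

end

section \<open>Elementary integrals and the elimination of the segment lengths\<close>

lemma integral_sin_sq_plus_cos_sq:
  fixes a b :: real
  assumes "a \<le> b"
  shows "integral {a..b} (\<lambda>t. (sin t)\<^sup>2) + integral {a..b} (\<lambda>t. (cos t)\<^sup>2) = b - a"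
proof -
  have "integral {a..b} (\<lambda>t. (sin t)\<^sup>2 + (cos t)\<^sup>2) = b - a"
    using assms by simp
  then show ?thesis
    by (subst (asm) Henstock_Kurzweil_Integration.integral_add)
       (auto intro!: integrable_continuous_interval continuous_intros)
qed

lemma integral_shifted_powr:
  fixes A U \<Delta> :: real
  assumes "U \<ge> 0" "\<Delta> > 0"
  shows "integral {A..A+U} (\<lambda>t. (t - A) powr \<Delta>) = U powr (\<Delta> + 1) / (\<Delta> + 1)"
proof -
  have "((\<lambda>t. t powr \<Delta>) has_integral (U powr (\<Delta> + 1) / (\<Delta> + 1))) (cbox 0 U)"
    using has_integral_powr_from_0[of \<Delta> U] assms by simp
  from has_integral_affinity[OF this, of 1 "- A"] show ?thesis
    using assms by (intro integral_unique) (simp add: add.commute image_add_atLeastAtMost)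
qed

text \<open>\<open>q\<close> is the product over the points of \<open>(t - \<pi>L)\<^sup>\<Delta>\<close>, \<open>d\<close> the denominator, \<open>w\<close> the
  length of the reverse iteration and \<open>x = \<alpha>\<^sub>0 - \<pi>L\<close>.\<close>

lemma power_quotient:
  fixes x q d w U \<Delta> :: real
  assumes "x > 0" "w > 0" "U > 0" "\<Delta> > 0"
    and "U powr (\<Delta> + 1) / (\<Delta> + 1) = x powr \<Delta> * q * w" "U = d * w"
  shows "(q / d) powr (1 / \<Delta>) = U / (x * (1 + \<Delta>) powr (1 / \<Delta>))"
proof -
  define c where "c = 1 + \<Delta>"
  define X where "X = x powr \<Delta>"
  define V where "V = U powr \<Delta>"
  have pos: "c > 0" "X > 0" using assms(1,4) by (auto simp: c_def X_def)
  have "V * U / c = X * q * w"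
    using assms(3,5) by (simp add: powr_add c_def X_def V_def add.commute mult.commute[of U])
  \<comment> \<open>Dividing by \<open>U = d * w\<close> next cancels \<open>w\<close> and one
    factor \<open>U\<close>, leaving \<open>(U / x) powr \<Delta> / (1 + \<Delta>)\<close>, whose
    root is the claim.\<close>
  then have "q * w = V / X / c * U" using pos by (simp add: field_simps)
  moreover have "q / d = q * w / U" using assms(2,6) by simp
  ultimately have "q / d = V / X / c" using assms(3) by simp
  then have "q / d = (U / x) powr \<Delta> / c"
    using assms(1-4) by (simp add: powr_divide X_def V_def)
  then show ?thesis
    using assms(1-4) by (simp add: powr_divide powr_mult powr_powr c_def)
qed

section \<open>Mean value points on the reverse iterations of a segment\<close>

locale ladder_segment = ladder +
  fixes A B :: real and k :: nat
  assumes A_less_B: "A < B"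
    and A_large: "\<And>r. r \<le> k \<Longrightarrow> rev_iter y0 \<mu> A r > x0 / 2"
begin

abbreviation \<phi> :: "real \<Rightarrow> real" where "\<phi> \<equiv> phi1 y0 \<mu>"
abbreviation a :: "nat \<Rightarrow> real" where "a \<equiv> rev_iter y0 \<mu> A"
abbreviation b :: "nat \<Rightarrow> real" where "b \<equiv> rev_iter y0 \<mu> B"
abbreviation W :: "real \<Rightarrow> real" where "W \<equiv> Ztilde_sq y0 \<mu>"

text \<open>Lets \<open>A_large\<close> constrain only the left ends: the right ends inherit the
  largeness by monotonicity of \<open>rev_step\<close>.\<close>

lemma a_less_b: "r \<le> k \<Longrightarrow> a r < b r"
proof (induction r)
  case (Suc r)
  then show ?case using A_large[of r] unfolding rev_iter_Suc by (intro rev_step_strict_mono) auto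
qed (simp add: A_less_B)

lemma phi_ends:
  assumes "r < k"
  shows "\<phi> (a (Suc r)) = a r" "\<phi> (b (Suc r)) = b r" "a (Suc r) \<in> regular"
  using assms A_large[of r] a_less_b[of r] unfolding rev_iter_Suc
  by (auto intro!: rev_step)

lemma segment_regular:
  assumes "r < k" "t \<ge> a (Suc r)"
  shows "t \<in> regular"
  using regular_upward[OF phi_ends(3)] assms by blast

lemma phi_less:
  assumes "r < k" "t \<ge> a (Suc r)" "t' \<ge> a (Suc r)"
  shows "\<phi> t < \<phi> t' \<longleftrightarrow> t < t'"
  using phi1_less_iff segment_regular[OF assms(1)] assms(2,3) regularD by blast

lemma phi_segment:
  assumes "r < k" "t \<in> {a (Suc r)..b (Suc r)}"
  shows "\<phi> t \<in> {a r..b r}"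
proof -
  have "a (Suc r) < b (Suc r)" using a_less_b assms(1) by simp
  then show ?thesis
    using phi_less[OF assms(1), of t "a (Suc r)"] phi_less[OF assms(1), of "b (Suc r)" t]
      phi_ends[OF assms(1)] assms(2) by auto
qed

lemma phi_open_segment:
  assumes "r < k" "t \<in> {a (Suc r)<..<b (Suc r)}"
  shows "\<phi> t \<in> {a r<..<b r}"
proof -
  have "a (Suc r) < b (Suc r)" using a_less_b assms(1) by simp
  then show ?thesis
    using phi_less[OF assms(1), of "a (Suc r)" t] phi_less[OF assms(1), of t "b (Suc r)"]
      phi_ends[OF assms(1)] assms(2) by auto
qed

lemma phi_iterate_segment:
  "j \<le> k \<Longrightarrow> t \<in> {a k..b k} \<Longrightarrow> (\<phi> ^^ j) t \<in> {a (k - j)..b (k - j)}"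
proof (induction j)
  case (Suc j)
  then have "(\<phi> ^^ j) t \<in> {a (Suc (k - Suc j))..b (Suc (k - Suc j))}"
    by (simp add: Suc_diff_Suc)
  from phi_segment[OF _ this] show ?case using Suc.prems by simp
qed simp

lemma phi_iterate_ends:
  "j \<le> k \<Longrightarrow> (\<phi> ^^ j) (a k) = a (k - j) \<and> (\<phi> ^^ j) (b k) = b (k - j)"
proof (induction j)
  case (Suc j)
  then show ?case using phi_ends[of "k - Suc j"] by (simp add: Suc_diff_Suc)
qed simp

text \<open>Chain rule along the orbit of \<open>t\<close>. The derivative is two-sided even at
  \<open>a k\<close> and \<open>b k\<close>, because these are regular points.\<close>

lemma phi_iterate_derivative:
  "j \<le> k \<Longrightarrow> t \<in> {a k..b k} \<Longrightarrow>
    ((\<phi> ^^ j) has_real_derivative (\<Prod>i<j. W ((\<phi> ^^ i) t))) (at t)"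
proof (induction j)
  case 0
  then show ?case by (simp add: id_def)
next
  case (Suc j)
  have "(\<phi> ^^ j) t \<in> {a (Suc (k - Suc j))..b (Suc (k - Suc j))}"
    using phi_iterate_segment[of j t] Suc.prems by (simp add: Suc_diff_Suc)
  then have "(\<phi> ^^ j) t \<in> regular"
    using segment_regular[of "k - Suc j" "(\<phi> ^^ j) t"] Suc.prems by simp
  from DERIV_chain2[OF phi1_differentiable[OF this] Suc.IH] show ?case
    using Suc.prems by (simp add: o_def mult.commute)
qed

lemma generated_point_exists:
  assumes f: "continuous_on {A..B} f" and "k \<ge> 1"
  shows "\<exists>p. p k \<in> {a k<..<b k} \<and> (\<forall>r\<in>{1..k}. p (r - 1) = \<phi> (p r)) \<and>
     integral {A..B} f = f (p 0) * (\<Prod>r=1..k. W (p r)) * (b k - a k)"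
proof -
  define H where "H = (\<lambda>t. integral {A..(\<phi> ^^ k) t} f)"
  have seg: "(\<phi> ^^ k) t \<in> {A..B}" if "t \<in> {a k..b k}" for t
    using phi_iterate_segment[of k t] that by simp
  \<comment> \<open>Taken within the closed segment, since outside it the iterate may leave
    \<open>{A..B}\<close>, where nothing is assumed about \<open>f\<close>.\<close>
  have H_deriv: "(H has_real_derivative f ((\<phi> ^^ k) t) * (\<Prod>i<k. W ((\<phi> ^^ i) t))) (at t within {a k..b k})"
    if t: "t \<in> {a k..b k}" for t
  proof -
    have "((\<lambda>x. integral {A..x} f) has_real_derivative f ((\<phi> ^^ k) t))
        (at ((\<phi> ^^ k) t) within (\<phi> ^^ k) ` {a k..b k})"
      using seg by (intro has_field_derivative_subset[OF integral_has_real_derivative[OF f seg[OF t]]]) blast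
    from DERIV_image_chain[OF this has_field_derivative_at_within[OF phi_iterate_derivative[OF _ t]]]
    show ?thesis by (simp add: H_def o_def)
  qed
  have ab: "a k < b k" using a_less_b by simp
  have "continuous_on {a k..b k} H"
    using H_deriv by (meson DERIV_continuous continuous_on_eq_continuous_within)
  moreover have H_at: "(H has_real_derivative f ((\<phi> ^^ k) t) * (\<Prod>i<k. W ((\<phi> ^^ i) t))) (at t)"
    if "a k < t" "t < b k" for t
    using H_deriv[of t] that at_within_Icc_at[of "a k" t "b k"] by simp
  ultimately obtain l c where c: "a k < c" "c < b k" "DERIV H c :> l" "H (b k) - H (a k) = (b k - a k) * l"
    using MVT[OF ab, of H] real_differentiable_def by metis
  have "l = f ((\<phi> ^^ k) c) * (\<Prod>i<k. W ((\<phi> ^^ i) c))"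
    using DERIV_unique[OF c(3) H_at] c(1,2) by simp
  moreover have "H (b k) - H (a k) = integral {A..B} f"
    using phi_iterate_ends[of k] by (simp add: H_def)
  \<comment> \<open>The mean value point \<open>c\<close> is the last of the points, so the orbit is
    indexed backwards and \<open>p 0\<close> is the full iterate.\<close>
  moreover define p where "p = (\<lambda>r. (\<phi> ^^ (k - r)) c)"
  moreover have "(\<Prod>r=1..k. W (p r)) = (\<Prod>i<k. W ((\<phi> ^^ i) c))"
    unfolding p_def
    by (rule prod.reindex_bij_witness[of _ "\<lambda>i. k - i" "\<lambda>r. k - r"]) auto
  moreover have "p (r - 1) = \<phi> (p r)" if "r \<in> {1..k}" for r
  proof -
    have "k - (r - 1) = Suc (k - r)" using that by auto
    then show ?thesis by (simp add: p_def)
  qed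
  ultimately show ?thesis
    using c by (intro exI[of _ p]) (auto simp: p_def mult_ac)
qed

text \<open>Descent from \<open>p k\<close>, one application of the ladder at a time. Applied to the
  power function, it makes \<open>p 0 - A\<close> positive and hence a legitimate base and
  divisor.\<close>

lemma generated_point_in_segment:
  assumes "p k \<in> {a k<..<b k}" "\<And>r. r \<in> {1..k} \<Longrightarrow> p (r - 1) = \<phi> (p r)"
  shows "p 0 \<in> {A<..<B}"
proof -
  have "p (k - j) \<in> {a (k - j)<..<b (k - j)}" if "j \<le> k" for j
    using that
  proof (induction j)
    case (Suc j)
    have "p (Suc (k - Suc j)) \<in> {a (Suc (k - Suc j))<..<b (Suc (k - Suc j))}"
      using Suc by (simp add: Suc_diff_Suc)
    from phi_open_segment[OF _ this] show ?case
      using assms(2)[of "Suc (k - Suc j)"] Suc.prems by simp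
  qed (use assms in simp)
  from this[of k] show ?thesis by simp
qed

lemma generated_iff:
  assumes "A = pi * real L" "B = A + U"
  shows "generated y0 \<mu> f U L k p \<longleftrightarrow>
    continuous_on {A..B} f \<and> (\<forall>t\<in>{A..B}. f t \<ge> 0) \<and> (\<exists>t\<in>{A..B}. f t \<noteq> 0) \<and> k \<ge> 1 \<and>
    p k \<in> {a k<..<b k} \<and> (\<forall>r\<in>{1..k}. p (r - 1) = \<phi> (p r)) \<and>
    integral {A..B} f = f (p 0) * (\<Prod>r=1..k. W (p r)) * (b k - a k)"
  by (simp add: generated_def assms Let_def)

lemma generated_exists:
  assumes "A = pi * real L" "B = A + U" "k \<ge> 1"
    and "continuous_on {A..B} f" "\<And>t. t \<in> {A..B} \<Longrightarrow> f t \<ge> 0"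
    and "t \<in> {A..B}" "f t \<noteq> 0"
  shows "\<exists>p. generated y0 \<mu> f U L k p"
  unfolding generated_iff[OF assms(1,2)]
  using generated_point_exists[OF assms(4,3)] assms(3-7) by blast

lemma trigonometric_powers_generated:
  fixes \<Delta> :: real
  assumes A: "A = pi * real L" and B: "B = A + U" and "k \<ge> 1" "U < pi / 2" "\<Delta> > 0"
  shows "\<exists>p. generated y0 \<mu> (\<lambda>t. (sin t)\<^sup>2) U L k p"
    and "\<exists>p. generated y0 \<mu> (\<lambda>t. (cos t)\<^sup>2) U L k p"
    and "\<exists>p. generated y0 \<mu> (\<lambda>t. (t - pi * real L) powr \<Delta>) U L k p"
proof -
  have U: "U > 0" using A_less_B B by simp
  have mem: "A \<in> {A..B}" "B \<in> {A..B}" using A_less_B by auto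
  \<comment> \<open>At the multiple \<open>A\<close> of \<open>pi\<close> the sine is 0 and the
    cosine 1 or -1. Hence \<open>B\<close> witnesses that the squared sine is not identically zero,
    and \<open>A\<close> does so for the cosine.\<close>
  have "sin B = sin U * cos A"
    by (simp add: B A sin_add mult.commute[of pi])
  moreover have "sin U \<noteq> 0" using U assms(4) sin_gt_zero[of U] by simp
  moreover have cosA: "cos A \<noteq> 0" by (simp add: A mult.commute[of pi])
  ultimately show "\<exists>p. generated y0 \<mu> (\<lambda>t. (sin t)\<^sup>2) U L k p"
    using mem by (intro generated_exists[OF A B assms(3), of _ B] continuous_intros) auto
  show "\<exists>p. generated y0 \<mu> (\<lambda>t. (cos t)\<^sup>2) U L k p"
    using mem cosA by (intro generated_exists[OF A B assms(3), of _ A] continuous_intros) auto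
  show "\<exists>p. generated y0 \<mu> (\<lambda>t. (t - pi * real L) powr \<Delta>) U L k p"
    using mem U assms(5) unfolding A[symmetric]
    by (intro generated_exists[OF A B assms(3), of _ B] continuous_on_powr' continuous_intros) (auto simp: B)
qed

text \<open>Holds for arbitrary generated points: the sine and cosine identities add up to
  \<open>U\<close> as denominator times \<open>b k - a k\<close>, and the power identity supplies
  the numerator.\<close>

lemma generated_quotient:
  fixes \<Delta> :: real
  assumes A: "A = pi * real L" and B: "B = A + U" and "\<Delta> > 0"
    and p1: "generated y0 \<mu> (\<lambda>t. (sin t)\<^sup>2) U L k p1"
    and p2: "generated y0 \<mu> (\<lambda>t. (cos t)\<^sup>2) U L k p2"
    and p3: "generated y0 \<mu> (\<lambda>t. (t - pi * real L) powr \<Delta>) U L k p3"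
  shows "p3 0 - pi * real L > 0"
    and "((\<Prod>r=1..k. W (p3 r)) / ((\<Prod>r=1..k. W (p2 r)) * (cos (p2 0))\<^sup>2
        + (\<Prod>r=1..k. W (p1 r)) * (sin (p1 0))\<^sup>2)) powr (1 / \<Delta>)
      = U / ((p3 0 - pi * real L) * (1 + \<Delta>) powr (1 / \<Delta>))"
proof -
  note gen = generated_iff[OF A B]
  have U: "U > 0" using A_less_B B by simp
  have w: "b k - a k > 0" using a_less_b[of k] by simp
  have "p3 0 \<in> {A<..<B}"
    using p3 unfolding gen by (intro generated_point_in_segment) auto
  then show pos: "p3 0 - pi * real L > 0" by (simp add: A)
  have "integral {A..B} (\<lambda>t. (t - A) powr \<Delta>) = U powr (\<Delta> + 1) / (\<Delta> + 1)"
    unfolding B using U assms(3) by (intro integral_shifted_powr) auto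
  then have 3: "U powr (\<Delta> + 1) / (\<Delta> + 1)
      = (p3 0 - pi * real L) powr \<Delta> * (\<Prod>r=1..k. W (p3 r)) * (b k - a k)"
    using p3 unfolding gen A by simp
  have "U = integral {A..B} (\<lambda>t. (sin t)\<^sup>2) + integral {A..B} (\<lambda>t. (cos t)\<^sup>2)"
    using integral_sin_sq_plus_cos_sq[of A B] A_less_B B by simp
  also have "\<dots> = ((\<Prod>r=1..k. W (p2 r)) * (cos (p2 0))\<^sup>2
        + (\<Prod>r=1..k. W (p1 r)) * (sin (p1 0))\<^sup>2) * (b k - a k)"
    using p1 p2 unfolding gen by (simp add: algebra_simps)
  finally show "((\<Prod>r=1..k. W (p3 r)) / ((\<Prod>r=1..k. W (p2 r)) * (cos (p2 0))\<^sup>2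
        + (\<Prod>r=1..k. W (p1 r)) * (sin (p1 0))\<^sup>2)) powr (1 / \<Delta>)
      = U / ((p3 0 - pi * real L) * (1 + \<Delta>) powr (1 / \<Delta>))"
    by (rule power_quotient[OF pos w U assms(3) 3])
qed

end

section \<open>The ratio formula for two exponents\<close>

theorem theorem2:
  fixes y0 :: real and \<mu> :: "real \<Rightarrow> real" and k0 :: nat
  assumes "y0 > 0"
    and "smooth_from y0 \<mu>"
    and "mono_on {y0..} \<mu>"
    and "\<not> bdd_above (\<mu> ` {y0..})"
    and "\<And>y. y \<ge> y0 \<Longrightarrow> \<mu> y \<ge> 7 * y * ln y"
  shows "\<exists>L0 :: nat. \<forall>L\<ge>L0. \<forall>U \<Delta>3 \<Delta>4 :: real. \<forall>k3 k4 :: nat.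
    0 < U \<and> U < pi / 2 \<and> \<Delta>3 > 0 \<and> \<Delta>4 > 0 \<and> \<Delta>3 \<noteq> \<Delta>4 \<and>
    1 \<le> k3 \<and> k3 \<le> k0 \<and> 1 \<le> k4 \<and> k4 \<le> k0 \<longrightarrow>
    (let f1 = (\<lambda>t. (sin t)\<^sup>2);
         f2 = (\<lambda>t. (cos t)\<^sup>2);
         f3 = (\<lambda>t. (t - pi * real L) powr \<Delta>3);
         f4 = (\<lambda>t. (t - pi * real L) powr \<Delta>4);
         points = (\<lambda>(\<alpha>1 :: nat \<Rightarrow> nat \<Rightarrow> real) (\<alpha>2 :: nat \<Rightarrow> nat \<Rightarrow> real)
                    (\<alpha>3 :: nat \<Rightarrow> real) (\<alpha>4 :: nat \<Rightarrow> real).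
            (\<forall>k\<in>{k3, k4}. generated y0 \<mu> f1 U L k (\<alpha>1 k) \<and> generated y0 \<mu> f2 U L k (\<alpha>2 k)) \<and>
            generated y0 \<mu> f3 U L k3 \<alpha>3 \<and> generated y0 \<mu> f4 U L k4 \<alpha>4);
         P = (\<lambda>(k :: nat) (\<alpha> :: nat \<Rightarrow> real). \<Prod>r=1..k. Ztilde_sq y0 \<mu> (\<alpha> r))
     in (\<exists>\<alpha>1 \<alpha>2 \<alpha>3 \<alpha>4. points \<alpha>1 \<alpha>2 \<alpha>3 \<alpha>4) \<and>
        (\<forall>\<alpha>1 \<alpha>2 \<alpha>3 \<alpha>4. points \<alpha>1 \<alpha>2 \<alpha>3 \<alpha>4 \<longrightarrow>
           (\<alpha>3 0 - pi * real L) / (\<alpha>4 0 - pi * real L)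
           * (P k3 \<alpha>3 / (P k3 (\<alpha>2 k3) * (cos (\<alpha>2 k3 0))\<^sup>2 + P k3 (\<alpha>1 k3) * (sin (\<alpha>1 k3 0))\<^sup>2))
               powr (1 / \<Delta>3)
           * (P k4 \<alpha>4 / (P k4 (\<alpha>2 k4) * (cos (\<alpha>2 k4 0))\<^sup>2 + P k4 (\<alpha>1 k4) * (sin (\<alpha>1 k4 0))\<^sup>2))
               powr (- 1 / \<Delta>4)
           = (1 + \<Delta>4) powr (1 / \<Delta>4) / (1 + \<Delta>3) powr (1 / \<Delta>3)))"
proof -
  interpret ladder y0 \<mu> using assms by unfold_locales
  have "filterlim (\<lambda>L. pi * real L) at_top sequentially"
    by (rule filterlim_tendsto_pos_mult_at_top[OF tendsto_const pi_gt_zero filterlim_real_sequentially])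
  \<comment> \<open>Only \<open>k0\<close> enters this choice, so one \<open>L0\<close> serves all
    \<open>U\<close>, all exponents and all \<open>k \<le> k0\<close>.\<close>
  from eventually_compose_filterlim[OF eventually_rev_iter_large[of k0] this]
  obtain L0 where L0: "\<And>L r. L \<ge> L0 \<Longrightarrow> r \<le> k0 \<Longrightarrow> rev_iter y0 \<mu> (pi * real L) r > x0 / 2"
    by (auto simp: eventually_sequentially)
  show ?thesis
  proof (rule exI[of _ L0], intro allI impI, elim conjE, unfold Let_def split_beta, rule conjI)
    fix L :: nat and U \<Delta>3 \<Delta>4 :: real and k3 k4 :: nat
    assume L: "L0 \<le> L" and U: "0 < U" "U < pi / 2" and \<Delta>: "0 < \<Delta>3" "0 < \<Delta>4"
      and k: "1 \<le> k3" "k3 \<le> k0" "1 \<le> k4" "k4 \<le> k0"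
    have seg: "ladder_segment y0 \<mu> (pi * real L) (pi * real L + U) k" if "k \<le> k0" for k
      using U L0[OF L] that by unfold_locales auto
    note gen = ladder_segment.trigonometric_powers_generated[OF seg refl refl _ U(2)]
    note quot = ladder_segment.generated_quotient[OF seg refl refl]
    \<comment> \<open>The points are chosen as a family indexed by \<open>k\<close>, so that a
      single choice is made when \<open>k3 = k4\<close>.\<close>
    have "\<forall>k\<in>{k3, k4}. \<exists>p. generated y0 \<mu> (\<lambda>t. (sin t)\<^sup>2) U L k p"
      using gen(1)[OF k(2,1) \<Delta>(1)] gen(1)[OF k(4,3) \<Delta>(1)] by blast
    then obtain q1 where q1: "\<forall>k\<in>{k3, k4}. generated y0 \<mu> (\<lambda>t. (sin t)\<^sup>2) U L k (q1 k)"
      by (rule bchoice[THEN exE])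
    have "\<forall>k\<in>{k3, k4}. \<exists>p. generated y0 \<mu> (\<lambda>t. (cos t)\<^sup>2) U L k p"
      using gen(2)[OF k(2,1) \<Delta>(1)] gen(2)[OF k(4,3) \<Delta>(1)] by blast
    then obtain q2 where q2: "\<forall>k\<in>{k3, k4}. generated y0 \<mu> (\<lambda>t. (cos t)\<^sup>2) U L k (q2 k)"
      by (rule bchoice[THEN exE])
    obtain q3 where q3: "generated y0 \<mu> (\<lambda>t. (t - pi * real L) powr \<Delta>3) U L k3 q3"
      using gen(3)[OF k(2,1) \<Delta>(1)] by blast
    obtain q4 where q4: "generated y0 \<mu> (\<lambda>t. (t - pi * real L) powr \<Delta>4) U L k4 q4"
      using gen(3)[OF k(4,3) \<Delta>(2)] by blast
    show "\<exists>\<alpha>1 \<alpha>2 \<alpha>3 \<alpha>4.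
        (\<forall>k\<in>{k3, k4}. generated y0 \<mu> (\<lambda>t. (sin t)\<^sup>2) U L k (\<alpha>1 k) \<and>
          generated y0 \<mu> (\<lambda>t. (cos t)\<^sup>2) U L k (\<alpha>2 k)) \<and>
        generated y0 \<mu> (\<lambda>t. (t - pi * real L) powr \<Delta>3) U L k3 \<alpha>3 \<and>
        generated y0 \<mu> (\<lambda>t. (t - pi * real L) powr \<Delta>4) U L k4 \<alpha>4"
      using q1 q2 q3 q4 by blast
    show "\<forall>\<alpha>1 \<alpha>2 \<alpha>3 \<alpha>4.
        (\<forall>k\<in>{k3, k4}. generated y0 \<mu> (\<lambda>t. (sin t)\<^sup>2) U L k (\<alpha>1 k) \<and>
          generated y0 \<mu> (\<lambda>t. (cos t)\<^sup>2) U L k (\<alpha>2 k)) \<and>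
        generated y0 \<mu> (\<lambda>t. (t - pi * real L) powr \<Delta>3) U L k3 \<alpha>3 \<and>
        generated y0 \<mu> (\<lambda>t. (t - pi * real L) powr \<Delta>4) U L k4 \<alpha>4 \<longrightarrow>
        (\<alpha>3 0 - pi * real L) / (\<alpha>4 0 - pi * real L)
           * ((\<Prod>r=1..k3. Ztilde_sq y0 \<mu> (\<alpha>3 r)) / ((\<Prod>r=1..k3. Ztilde_sq y0 \<mu> (\<alpha>2 k3 r)) * (cos (\<alpha>2 k3 0))\<^sup>2
              + (\<Prod>r=1..k3. Ztilde_sq y0 \<mu> (\<alpha>1 k3 r)) * (sin (\<alpha>1 k3 0))\<^sup>2)) powr (1 / \<Delta>3)
           * ((\<Prod>r=1..k4. Ztilde_sq y0 \<mu> (\<alpha>4 r)) / ((\<Prod>r=1..k4. Ztilde_sq y0 \<mu> (\<alpha>2 k4 r)) * (cos (\<alpha>2 k4 0))\<^sup>2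
              + (\<Prod>r=1..k4. Ztilde_sq y0 \<mu> (\<alpha>1 k4 r)) * (sin (\<alpha>1 k4 0))\<^sup>2)) powr (- 1 / \<Delta>4)
           = (1 + \<Delta>4) powr (1 / \<Delta>4) / (1 + \<Delta>3) powr (1 / \<Delta>3)"
    proof (intro allI impI, elim conjE)
      fix \<alpha>1 \<alpha>2 :: "nat \<Rightarrow> nat \<Rightarrow> real" and \<alpha>3 \<alpha>4 :: "nat \<Rightarrow> real"
      assume "\<forall>k\<in>{k3, k4}. generated y0 \<mu> (\<lambda>t. (sin t)\<^sup>2) U L k (\<alpha>1 k) \<and>
          generated y0 \<mu> (\<lambda>t. (cos t)\<^sup>2) U L k (\<alpha>2 k)"
      then have g12: "generated y0 \<mu> (\<lambda>t. (sin t)\<^sup>2) U L k3 (\<alpha>1 k3)"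
          "generated y0 \<mu> (\<lambda>t. (cos t)\<^sup>2) U L k3 (\<alpha>2 k3)"
          "generated y0 \<mu> (\<lambda>t. (sin t)\<^sup>2) U L k4 (\<alpha>1 k4)"
          "generated y0 \<mu> (\<lambda>t. (cos t)\<^sup>2) U L k4 (\<alpha>2 k4)"
        by auto
      assume g3: "generated y0 \<mu> (\<lambda>t. (t - pi * real L) powr \<Delta>3) U L k3 \<alpha>3"
        and g4: "generated y0 \<mu> (\<lambda>t. (t - pi * real L) powr \<Delta>4) U L k4 \<alpha>4"
      note q3 = quot[OF k(2) \<Delta>(1) g12(1,2) g3] and q4 = quot[OF k(4) \<Delta>(2) g12(3,4) g4]
      have neg: "- 1 / \<Delta>4 = - (1 / \<Delta>4)" by simp
      show "(\<alpha>3 0 - pi * real L) / (\<alpha>4 0 - pi * real L)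
           * ((\<Prod>r=1..k3. Ztilde_sq y0 \<mu> (\<alpha>3 r)) / ((\<Prod>r=1..k3. Ztilde_sq y0 \<mu> (\<alpha>2 k3 r)) * (cos (\<alpha>2 k3 0))\<^sup>2
              + (\<Prod>r=1..k3. Ztilde_sq y0 \<mu> (\<alpha>1 k3 r)) * (sin (\<alpha>1 k3 0))\<^sup>2)) powr (1 / \<Delta>3)
           * ((\<Prod>r=1..k4. Ztilde_sq y0 \<mu> (\<alpha>4 r)) / ((\<Prod>r=1..k4. Ztilde_sq y0 \<mu> (\<alpha>2 k4 r)) * (cos (\<alpha>2 k4 0))\<^sup>2
              + (\<Prod>r=1..k4. Ztilde_sq y0 \<mu> (\<alpha>1 k4 r)) * (sin (\<alpha>1 k4 0))\<^sup>2)) powr (- 1 / \<Delta>4)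
           = (1 + \<Delta>4) powr (1 / \<Delta>4) / (1 + \<Delta>3) powr (1 / \<Delta>3)"
        \<comment> \<open>The negative exponent inverts the second quotient; \<open>U\<close> and
          the distances from \<open>pi * real L\<close> then cancel, leaving only the constants in
          the exponents.\<close>
        unfolding neg powr_minus q3(2) q4(2)
        using q3(1) q4(1) U(1) \<Delta> by (simp add: divide_simps)
    qed
  qed
qed

end
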